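(* Let $n\ge 1$, $c\in\{1,\dots,n\}$ and $r\ge n+1$ be integers. Let $H\subset\mathbb{P}^n$ be a hyperplane such that $H\cap\Delta_0=\emptyset$. Let $P_1,\dots,P_r\in H\setminus\Delta_{n-1}$ and let $H_i=P_i\star H$ for all $i\in\{1,\dots,r\}$. Then $\mathbb{X}_c(H_1,\dots,H_r)$ is a Hadamard star configuration if and only if $\sigma(P_1),\dots,\sigma(P_r)$ are in general position in $\mathbb{P}^n$.
   Context: Work over $\mathbb{C}$; $S=\mathbb{C}[x_0,\dots,x_n]$ is the coordinate ring of $\mathbb{P}^n$, and $S_1$ is the space of linear forms. $\Delta_i=\bigcup_{0\le j_1<\dots<j_{n-i}\le n}V(x_{j_1})\cap\dots\cap V(x_{j_{n-i}})$, i.e. the set of points with at most $i+1$ nonzero coordinates. So $\Delta_0$ is the set of coordinate points and $\Delta_{n-1}$ is the set of points with at least one zero coordinate. Hadamard product: for points $A=[a_0:\dots:a_n]$, $B=[b_0:\dots:b_n]$ with $a_ib_i\ne0$ for some $i$, $A\star B=[a_0b_0:\dots:a_nb_n]$ (otherwise it is not defined). For a point $P$ and a variety $X$, $P\star X$ is the closure of $\{P\star Q: Q\in X,\ P\star Q\text{ defined}\}$. If $P=[p_0:\dots:p_n]\notin\Delta_{n-1}$ and $H=V(\sum a_ix_i)$, then $P\star H=V(\sum (a_i/p_i)x_i)$. $\sigma:\mathbb{P}^n\dashrightarrow\mathbb{P}^n$ is the standard Cremona transformation $\sigma([p_0:\dots:p_n])=[1/p_0:\dots:1/p_n]$. Points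 $Q_1,\dots,Q_r$ ($r\ge n+1$) of $\mathbb{P}^n$ are in general position if no hyperplane contains $n+1$ of them (with distinct indices); equivalently, all maximal minors of the $r\times(n+1)$ matrix whose rows are the $Q_i$ are nonzero. A collection of linear forms $\mathcal{L}=\{L_1,\dots,L_r\}\subset S_1$ is generally linear if any $t\le n$ of them have common zero locus of dimension $n-t$ and any $t>n$ of them have empty common zero locus in $\mathbb{P}^n$. For generally linear $\mathcal{L}$ and $1\le c\le n$, the codimension $c$ star configuration defined by $\mathcal{L}$ is $\mathbb{X}_c(\mathcal{L})=\bigcup_{1\le i_1<\dots<i_c\le r}V(L_{i_1},\dots,L_{i_c})$. $\mathcal{L}$ is a Hadamard set if there are a linear form $L\in S_1$ and points $P_1,\dots,P_r\in\mathbb{P}^n$ with $V(L_i)=P_i\star V(L)$ for all $i$; it is a strong Hadamard set if moreover $P_i\in V(L)$ for all $i$. A star configuration $\mathbb{X}_c(\mathcal{L})$ is a Hadamard star configuration (HSC) if $\mathcal{L}$ is a strong Hadamard set. For hyperplanes $H_i=V(L_i)$, $\mathbb{X}_c(H_1,\dots,H_r)=\bigcup_{1\le i_1<\dots<i_c\le r}H_{i_1}\cap\dots\cap H_{i_c}$; it is called an HSC when $\{L_1,\dots,L_r\}$ is generally linear (so that it is a star configuration) and is a strong Hadamard set. *)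

theory Defs
  imports "HOL-Analysis.Analysis"
begin

section \<open>Projective space\<close>

text \<open>
  Projective n-space over the complex numbers is the quotient of the nonzero vectors of
  \<open>complex^'n\<close> by scaling, where the homogeneous coordinates are indexed by the finite type
  \<open>'n\<close>; hence n is \<open>CARD('n) - 1\<close>.
\<close>

definition proportional :: "complex^'n \<Rightarrow> complex^'n \<Rightarrow> bool" where
  "proportional v w \<longleftrightarrow> v \<noteq> 0 \<and> (\<exists>k. k \<noteq> 0 \<and> w = k *s v)"

lemma part_equivp_proportional: "part_equivp (proportional :: complex^'n \<Rightarrow> _)"
proof (rule part_equivpI)
  show "\<exists>x::complex^'n. proportional x x"
    by (rule exI[of _ "1"], unfold proportional_def, intro conjI exI[of _ 1]) auto
  show "symp (proportional :: complex^'n \<Rightarrow> _)"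
  proof (rule sympI)
    fix v w :: "complex^'n"
    assume "proportional v w"
    then obtain k where k: "v \<noteq> 0" "k \<noteq> 0" "w = k *s v"
      unfolding proportional_def by blast
    then have "v = inverse k *s w" "w \<noteq> 0"
      by (auto simp: vector_smult_assoc)
    then show "proportional w v"
      using k(2) unfolding proportional_def by (intro conjI exI[of _ "inverse k"]) auto
  qed
  show "transp (proportional :: complex^'n \<Rightarrow> _)"
  proof (rule transpI)
    fix u v w :: "complex^'n"
    assume "proportional u v" "proportional v w"
    then obtain k l where "u \<noteq> 0" "k \<noteq> 0" "l \<noteq> 0" "w = (l * k) *s u"
      by (auto simp: proportional_def vector_smult_assoc)
    then show "proportional u w"
      unfolding proportional_def by (intro conjI exI[of _ "l * k"]) auto
  qed
qed

quotient_type 'n proj = "complex^'n" / partial: proportional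
  morphisms coords point
  by (rule part_equivp_proportional)

text \<open>
  \<open>point v\<close> is the point with homogeneous coordinates \<open>v\<close> (meaningful for \<open>v \<noteq> 0\<close>);
  \<open>coords P\<close> is an arbitrary choice of homogeneous coordinates of \<open>P\<close>, unique up to a nonzero
  scalar. All notions below are independent of this choice.
\<close>

lemma coords_nonzero: "coords P \<noteq> 0"
  using Quotient_rel_rep[OF Quotient_proj, of P P] by (auto simp: proportional_def)

lemma point_coords: "point (coords P) = P"
  by (rule Quotient_abs_rep[OF Quotient_proj])

lemma proportional_coords_point: "v \<noteq> 0 \<Longrightarrow> proportional v (coords (point v))"
  by (rule part_equivp_symp[OF part_equivp_proportional], rule Quotient_rep_abs[OF Quotient_proj])
    (auto simp: proportional_def intro: exI[of _ 1])

lemma coords_point: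
  assumes "v \<noteq> 0"
  obtains k where "k \<noteq> 0" "coords (point v) = k *s v"
  using proportional_coords_point[OF assms] by (auto simp: proportional_def)

lemma point_eq_iff: "v \<noteq> 0 \<Longrightarrow> w \<noteq> 0 \<Longrightarrow> point v = point w \<longleftrightarrow> (\<exists>k. k \<noteq> 0 \<and> w = k *s v)"
  using Quotient_rel[OF Quotient_proj, of v w]
  by (auto simp: proportional_def intro: exI[of _ 1])


section \<open>Forms, zero loci and the Zariski closure\<close>

text \<open>
  The graded piece \<open>S\<^sub>d\<close> of the coordinate ring. Since the complex numbers are infinite,
  homogeneous polynomials are identified with the functions they induce on \<open>complex^'n\<close>;
  a monomial is given by its exponent function \<open>m\<close>. The zero form belongs to every \<open>S\<^sub>d\<close>.
\<close>

definition forms :: "nat \<Rightarrow> (complex^'n \<Rightarrow> complex) set" where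
  "forms d = {f. \<exists>a :: ('n \<Rightarrow> nat) \<Rightarrow> complex.
     f = (\<lambda>x. \<Sum>m | (\<Sum>i\<in>UNIV. m i) = d. a m * (\<Prod>i\<in>UNIV. (x $ i) ^ m i))}"

definition zero_locus :: "(complex^'n \<Rightarrow> complex) set \<Rightarrow> 'n proj set" where
  "zero_locus F = {P. \<forall>f\<in>F. f (coords P) = 0}"

lemma finite_exponents: "finite {m :: 'n::finite \<Rightarrow> nat. (\<Sum>i\<in>UNIV. m i) = d}"
proof (rule finite_subset)
  show "{m :: 'n \<Rightarrow> nat. (\<Sum>i\<in>UNIV. m i) = d} \<subseteq> PiE UNIV (\<lambda>_. {..d})"
    by (auto intro: member_le_sum)
  show "finite (PiE (UNIV :: 'n set) (\<lambda>_. {..d}))"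
    by (intro finite_PiE) auto
qed

lemma linear_forms_iff: "f \<in> forms 1 \<longleftrightarrow> (\<exists>a. f = (\<lambda>x::complex^'n. \<Sum>i\<in>UNIV. a i * x $ i))"
proof -
  define e :: "'n \<Rightarrow> 'n \<Rightarrow> nat" where "e j = (\<lambda>i. if i = j then 1 else 0)" for j
  have inj: "inj e"
    by (auto simp: inj_def e_def fun_eq_iff split: if_splits)
  have "m \<in> range e" if m1: "(\<Sum>i\<in>UNIV. m i) = 1" for m
  proof -
    obtain j where "m j = 1" "\<forall>i. j \<noteq> i \<longrightarrow> m i = 0"
      using sum_eq_1_iff[of UNIV m] m1 by (simp only: finite) blast
    then have "m = e j"
      by (auto simp: e_def fun_eq_iff)
    then show ?thesis
      by blast
  qed
  then have exps: "{m. (\<Sum>i\<in>UNIV. m i) = 1} = range e"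
    by (auto simp: e_def)
  have "(\<Prod>i\<in>UNIV. (x $ i) ^ e j i) = x $ j" for x :: "complex^'n" and j
  proof -
    have "(\<Prod>i\<in>UNIV. (x $ i) ^ e j i) = (\<Prod>i\<in>UNIV. if i = j then x $ i else 1)"
      by (rule prod.cong) (auto simp: e_def)
    then show ?thesis
      by simp
  qed
  then have sum_eq: "(\<Sum>m | (\<Sum>i\<in>UNIV. m i) = 1. a m * (\<Prod>i\<in>UNIV. (x $ i) ^ m i)) =
      (\<Sum>j\<in>UNIV. a (e j) * x $ j)" for x :: "complex^'n" and a :: "('n \<Rightarrow> nat) \<Rightarrow> complex"
    unfolding exps by (simp add: sum.reindex[OF inj])
  show ?thesis
  proof
    assume "f \<in> forms 1"
    then obtain a where "f = (\<lambda>x. \<Sum>j\<in>UNIV. a (e j) * x $ j)"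
      unfolding forms_def sum_eq mem_Collect_eq by (elim exE)
    then show "\<exists>a. f = (\<lambda>x. \<Sum>i\<in>UNIV. a i * x $ i)"
      by (intro exI[of _ "\<lambda>j. a (e j)"])
  next
    assume "\<exists>a. f = (\<lambda>x. \<Sum>i\<in>UNIV. a i * x $ i)"
    then obtain a where "f = (\<lambda>x. \<Sum>i\<in>UNIV. a i * x $ i)"
      by (elim exE)
    then have "f = (\<lambda>x. \<Sum>j\<in>UNIV. (a \<circ> inv e) (e j) * x $ j)"
      by (simp add: inv_f_f[OF inj])
    then show "f \<in> forms 1"
      unfolding forms_def sum_eq mem_Collect_eq by (intro exI[of _ "a \<circ> inv e"])
  qed
qed

lemma forms_homogeneous:
  assumes "f \<in> forms d"
  shows "f (k *s v) = k ^ d * f v"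
proof -
  obtain a where f: "f = (\<lambda>x. \<Sum>m | (\<Sum>i\<in>UNIV. m i) = d. a m * (\<Prod>i\<in>UNIV. (x $ i) ^ m i))"
    using assms unfolding forms_def by blast
  have "(\<Prod>i\<in>UNIV. (k * v $ i) ^ m i) = k ^ (\<Sum>i\<in>UNIV. m i) * (\<Prod>i\<in>UNIV. (v $ i) ^ m i)" for m
    by (simp add: power_mult_distrib prod.distrib power_sum)
  then show ?thesis
    unfolding f by (simp add: sum_distrib_left mult_ac)
qed

lemma point_in_zero_locus:
  assumes "v \<noteq> 0" and "\<And>f. f \<in> F \<Longrightarrow> \<exists>d. f \<in> forms d"
  shows "point v \<in> zero_locus F \<longleftrightarrow> (\<forall>f\<in>F. f v = 0)"
proof -
  obtain k where k: "k \<noteq> 0" "coords (point v) = k *s v"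
    using coords_point[OF assms(1)] .
  have "f (coords (point v)) = 0 \<longleftrightarrow> f v = 0" if "f \<in> F" for f
  proof -
    obtain d where "f \<in> forms d"
      using assms(2)[OF \<open>f \<in> F\<close>] by blast
    then show ?thesis
      using k by (simp add: forms_homogeneous)
  qed
  then show ?thesis
    unfolding zero_locus_def by auto
qed

definition zariski_closed :: "'n::finite proj set \<Rightarrow> bool" where
  "zariski_closed Z \<longleftrightarrow> (\<exists>F \<subseteq> (\<Union>d. forms d). Z = zero_locus F)"

definition zariski_closure :: "'n::finite proj set \<Rightarrow> 'n proj set" where
  "zariski_closure X = \<Inter>{Z. zariski_closed Z \<and> X \<subseteq> Z}"

definition hyperplane :: "'n::finite proj set \<Rightarrow> bool" where
  "hyperplane H \<longleftrightarrow> (\<exists>L \<in> forms 1. L \<noteq> (\<lambda>_. 0) \<and> H = zero_locus {L})"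

text \<open>
  The dimension of a projective linear subspace is one less than the dimension of the vector
  subspace of \<open>complex^'n\<close> lying over it; in particular the empty set has dimension -1. This is
  only used for common zero loci of linear forms.
\<close>

definition proj_dim :: "'n::finite proj set \<Rightarrow> int" where
  "proj_dim X = int (vec.dim {v. v = 0 \<or> point v \<in> X}) - 1"

definition \<Delta> :: "nat \<Rightarrow> 'n::finite proj set" where
  "\<Delta> i = (\<Union>J \<in> {J :: 'n set. card J = CARD('n) - 1 - i}. zero_locus ((\<lambda>j x. x $ j) ` J))"


section \<open>Hadamard products and the Cremona transformation\<close>

text \<open>On \<open>complex^'n\<close>, \<open>*\<close> is the componentwise product. \<open>None\<close> means "not defined".\<close>

definition hadamard :: "'n::finite proj \<Rightarrow> 'n proj \<Rightarrow> 'n proj option" where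
  "hadamard A B =
     (if \<exists>i. coords A $ i * coords B $ i \<noteq> 0 then Some (point (coords A * coords B)) else None)"

lemma hadamard_point:
  assumes "a \<noteq> 0" "b \<noteq> 0"
  shows "hadamard (point a) (point b) =
    (if \<exists>i. a $ i * b $ i \<noteq> 0 then Some (point (a * b)) else None)"
proof -
  obtain k where k: "k \<noteq> 0" "coords (point a) = k *s a"
    using coords_point[OF assms(1)] .
  obtain l where l: "l \<noteq> 0" "coords (point b) = l *s b"
    using coords_point[OF assms(2)] .
  have eq: "(k *s a) * (l *s b) = (k * l) *s (a * b)"
    by (simp add: vec_eq_iff)
  have "point (a * b) = point ((k * l) *s (a * b))" if "a * b \<noteq> 0"
    using that k(1) l(1) by (subst point_eq_iff) (auto intro: exI[of _ "k * l"])
  moreover have "(\<exists>i. a $ i * b $ i \<noteq> 0) \<longleftrightarrow> a * b \<noteq> 0"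
    by (simp add: vec_eq_iff)
  ultimately show ?thesis
    using k l by (auto simp: hadamard_def eq)
qed

definition hadamard_variety :: "'n::finite proj \<Rightarrow> 'n proj set \<Rightarrow> 'n proj set" (infixr \<open>\<star>\<close> 75) where
  "P \<star> X = zariski_closure {R. \<exists>Q\<in>X. hadamard P Q = Some R}"

text \<open>Only meaningful for points without zero coordinates.\<close>

definition cremona :: "'n::finite proj \<Rightarrow> 'n proj" (\<open>\<sigma>\<close>) where
  "\<sigma> P = point (\<chi> i. 1 / coords P $ i)"

lemma cremona_point:
  assumes "\<And>i. p $ i \<noteq> 0"
  shows "\<sigma> (point p) = point (\<chi> i. 1 / p $ i)"
proof -
  have "p \<noteq> 0"
    using assms by auto
  then obtain k where k: "k \<noteq> 0" "coords (point p) = k *s p"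
    by (rule coords_point)
  show ?thesis
    unfolding cremona_def k(2)
    using k(1) assms
    by (subst point_eq_iff) (auto simp: vec_eq_iff intro!: exI[of _ k])
qed


section \<open>General position and Hadamard star configurations\<close>

text \<open>
  Families of \<open>r\<close> points, forms or hyperplanes are functions on \<open>nat\<close>, of which only the values
  on \<open>{1..r}\<close> matter; "any t of them" means any t distinct indices, so repetitions count.
\<close>

definition general_position :: "nat \<Rightarrow> (nat \<Rightarrow> 'n::finite proj) \<Rightarrow> bool" where
  "general_position r Q \<longleftrightarrow>
     \<not> (\<exists>H I. hyperplane H \<and> I \<subseteq> {1..r} \<and> card I = CARD('n) \<and> Q ` I \<subseteq> H)"

definition generally_linear :: "nat \<Rightarrow> (nat \<Rightarrow> complex^'n \<Rightarrow> complex) \<Rightarrow> bool" where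
  "generally_linear r L \<longleftrightarrow>
     (\<forall>i\<in>{1..r}. L i \<in> forms 1) \<and>
     (\<forall>I \<subseteq> {1..r}.
        (card I \<le> CARD('n) - 1 \<longrightarrow>
           proj_dim (zero_locus (L ` I)) = int (CARD('n) - 1) - int (card I)) \<and>
        (card I > CARD('n) - 1 \<longrightarrow> zero_locus (L ` I) = {}))"

definition strong_hadamard_set :: "nat \<Rightarrow> (nat \<Rightarrow> complex^'n \<Rightarrow> complex) \<Rightarrow> bool" where
  "strong_hadamard_set r L \<longleftrightarrow>
     (\<exists>M \<in> forms 1. \<exists>P. \<forall>i\<in>{1..r}.
        zero_locus {L i} = P i \<star> zero_locus {M} \<and> P i \<in> zero_locus {M})"

definition star_locus :: "nat \<Rightarrow> nat \<Rightarrow> (nat \<Rightarrow> 'n::finite proj set) \<Rightarrow> 'n proj set" (\<open>\<X>\<close>) where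
  "\<X> c r H = (\<Union>I \<in> {I. I \<subseteq> {1..r} \<and> card I = c}. \<Inter>i\<in>I. H i)"

definition star_configuration ::
    "nat \<Rightarrow> nat \<Rightarrow> (nat \<Rightarrow> complex^'n \<Rightarrow> complex) \<Rightarrow> 'n proj set \<Rightarrow> bool" where
  "star_configuration c r L X \<longleftrightarrow>
     1 \<le> c \<and> c \<le> CARD('n) - 1 \<and> generally_linear r L \<and>
     X = (\<Union>I \<in> {I. I \<subseteq> {1..r} \<and> card I = c}. zero_locus (L ` I))"

text \<open>
  Being a Hadamard star configuration is a property of the family of hyperplanes (through linear
  forms defining them, which are unique up to scalars), not just of the set \<open>\<X> c r H\<close>.
\<close>

definition hadamard_star_configuration :: "nat \<Rightarrow> nat \<Rightarrow> (nat \<Rightarrow> 'n::finite proj set) \<Rightarrow> bool" where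
  "hadamard_star_configuration c r H \<longleftrightarrow>
     (\<exists>L. (\<forall>i\<in>{1..r}. H i = zero_locus {L i}) \<and>
          star_configuration c r L (\<X> c r H) \<and> strong_hadamard_set r L)"

end

theory Submission
  imports Defs
begin

text \<open>
  Write \<open>H = V(\<Sum> a\<^sub>i x\<^sub>i)\<close>. Since \<open>H\<close> misses the coordinate points, every \<open>a\<^sub>i\<close> is nonzero;
  since \<open>P\<close> has no zero coordinate, multiplication by \<open>P\<close> is a projective automorphism, and it
  carries \<open>H\<close> onto \<open>V(\<Sum> (a\<^sub>i / p\<^sub>i) x\<^sub>i)\<close> (\<open>hadamard_variety_hyperplane\<close>). So the coefficient
  vector of \<open>P \<star> H\<close> is \<open>a * q\<close> with \<open>q\<close> the coordinate vector of \<open>\<sigma> P\<close>.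

  The bilinear pairing satisfies \<open>\<langle>a * q, v\<rangle> = \<langle>a * v, q\<rangle>\<close>: the point \<open>v\<close> lies on \<open>P \<star> H\<close> exactly
  when the hyperplane with coefficients \<open>a * v\<close> passes through \<open>\<sigma> P\<close>. As \<open>v \<mapsto> a * v\<close> is
  invertible, \<open>n + 1\<close> of the hyperplanes \<open>P\<^sub>i \<star> H\<close> have a common point if and only if the
  corresponding \<open>n + 1\<close> points \<open>\<sigma> P\<^sub>i\<close> lie on a common hyperplane
  (\<open>general_position_cremona_iff\<close>).

  It remains to see that generality of the linear forms is decided by their \<open>(n + 1)\<close>-subsets. A
  larger set of forms contains such a subset; a smaller one extends to it because \<open>r \<ge> n + 1\<close>, and
  since the \<open>n + 1\<close> forms are then coordinates on the whole space, the common zeros of \<open>k\<close> of them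
  form a coordinate subspace of codimension \<open>k\<close> (\<open>generally_linear_lin_formI\<close>). The points
  \<open>P\<^sub>i\<close> lie on \<open>H\<close> by assumption, which makes the Hadamard set strong.
\<close>

section \<open>Linear forms by coefficient vectors\<close>

definition lin_form :: "complex^'n \<Rightarrow> complex^'n \<Rightarrow> complex" where
  "lin_form a = (\<lambda>x. \<Sum>i\<in>UNIV. a $ i * x $ i)"

lemma lin_form_in_forms: "lin_form a \<in> forms 1"
  unfolding linear_forms_iff lin_form_def by (intro exI[of _ "\<lambda>i. a $ i"]) simp

lemma forms_1E:
  assumes "L \<in> forms 1"
  obtains a where "L = lin_form a"
proof -
  obtain f where "L = (\<lambda>x. \<Sum>i\<in>UNIV. f i * x $ i)"
    using assms unfolding linear_forms_iff by blast
  then have "L = lin_form (\<chi> i. f i)"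
    by (simp add: lin_form_def)
  then show thesis
    by (rule that)
qed

lemma lin_form_axis: "lin_form a (axis j 1) = a $ j" "lin_form (axis j 1) x = x $ j"
proof -
  have "a $ i * axis j 1 $ i = (if i = j then a $ i else 0)"
    and "axis j 1 $ i * x $ i = (if i = j then x $ i else 0)" for i
    by (auto simp: axis_def)
  then show "lin_form a (axis j 1) = a $ j" "lin_form (axis j 1) x = x $ j"
    unfolding lin_form_def by simp_all
qed

lemma lin_form_eq_zero_iff: "lin_form a = (\<lambda>_. 0) \<longleftrightarrow> a = 0"
proof
  assume "lin_form a = (\<lambda>_. 0)"
  then have "a $ j = 0" for j
    using lin_form_axis(1)[of a j] by simp
  then show "a = 0"
    by (simp add: vec_eq_iff)
qed (auto simp: lin_form_def)

lemma lin_form_mult: "lin_form (a * b) v = lin_form (a * v) b"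
  unfolding lin_form_def by (simp add: mult_ac)

lemma point_in_lin_form_locus:
  "v \<noteq> 0 \<Longrightarrow> point v \<in> zero_locus (lin_form ` A) \<longleftrightarrow> (\<forall>a\<in>A. lin_form a v = 0)"
  by (subst point_in_zero_locus) (auto intro: lin_form_in_forms)

lemma point_in_lin_form_hyperplane:
  "v \<noteq> 0 \<Longrightarrow> point v \<in> zero_locus {lin_form a} \<longleftrightarrow> lin_form a v = 0"
  using point_in_lin_form_locus[of v "{a}"] by simp

lemma zero_locus_image: "zero_locus (L ` I) = (\<Inter>i\<in>I. zero_locus {L i})"
  by (auto simp: zero_locus_def)

lemma lin_form_locus_empty_iff:
  "(\<Inter>i\<in>I. zero_locus {lin_form (b i)}) = {} \<longleftrightarrow>
    (\<forall>v. (\<forall>i\<in>I. lin_form (b i) v = 0) \<longrightarrow> v = 0)"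
proof
  assume empty: "(\<Inter>i\<in>I. zero_locus {lin_form (b i)}) = {}"
  show "\<forall>v. (\<forall>i\<in>I. lin_form (b i) v = 0) \<longrightarrow> v = 0"
  proof (intro allI impI, rule ccontr)
    fix v assume "\<forall>i\<in>I. lin_form (b i) v = 0" "v \<noteq> 0"
    then have "point v \<in> (\<Inter>i\<in>I. zero_locus {lin_form (b i)})"
      by (simp add: point_in_lin_form_hyperplane)
    then show False
      using empty by blast
  qed
next
  assume "\<forall>v. (\<forall>i\<in>I. lin_form (b i) v = 0) \<longrightarrow> v = 0"
  then show "(\<Inter>i\<in>I. zero_locus {lin_form (b i)}) = {}"
    using coords_nonzero by (fastforce simp: zero_locus_def)
qed

lemma hyperplane_iff: "hyperplane H \<longleftrightarrow> (\<exists>a. a \<noteq> 0 \<and> H = zero_locus {lin_form a})"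
proof
  assume "hyperplane H"
  then obtain L where L: "L \<in> forms 1" "L \<noteq> (\<lambda>_. 0)" "H = zero_locus {L}"
    unfolding hyperplane_def by blast
  obtain a where "L = lin_form a"
    using forms_1E[OF L(1)] .
  then show "\<exists>a. a \<noteq> 0 \<and> H = zero_locus {lin_form a}"
    using L lin_form_eq_zero_iff by blast
next
  assume "\<exists>a. a \<noteq> 0 \<and> H = zero_locus {lin_form a}"
  then show "hyperplane H"
    unfolding hyperplane_def using lin_form_in_forms lin_form_eq_zero_iff by blast
qed


section \<open>Coordinate points and coordinate hyperplanes\<close>

lemma axis_point_in_Delta_0: "point (axis i 1) \<in> (\<Delta> 0 :: 'n::finite proj set)"
proof -
  have "card (UNIV - {i} :: 'n set) = CARD('n) - 1 - 0"
    by (simp add: card_Diff_singleton)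
  moreover have "point (axis i 1) \<in> zero_locus ((\<lambda>j x. x $ j) ` (UNIV - {i}))"
  proof -
    have "point (axis i 1) \<in> zero_locus (lin_form ` (\<lambda>j. axis j 1) ` (UNIV - {i}))"
      by (subst point_in_lin_form_locus)
        (auto simp: lin_form_axis axis_eq_axis, auto simp: axis_def split: if_splits)
    then show ?thesis
      by (simp add: image_image zero_locus_def lin_form_axis(2))
  qed
  ultimately show ?thesis
    unfolding \<Delta>_def by blast
qed

lemma coefficients_nonzero_if_disjoint_Delta_0:
  assumes "zero_locus {lin_form a} \<inter> \<Delta> 0 = {}"
  shows "a $ i \<noteq> 0"
proof
  assume "a $ i = 0"
  then have "point (axis i 1) \<in> zero_locus {lin_form a}"
    by (subst point_in_lin_form_hyperplane) (auto simp: lin_form_axis)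
  then show False
    using assms axis_point_in_Delta_0 by blast
qed

lemma coords_nonzero_if_notin_Delta:
  fixes P :: "'n::finite proj"
  assumes "CARD('n) = n + 1" "n \<ge> 1" "P \<notin> \<Delta> (n - 1)"
  shows "coords P $ i \<noteq> 0"
proof
  assume "coords P $ i = 0"
  then have "P \<in> zero_locus ((\<lambda>j x. x $ j) ` {i})"
    by (simp add: zero_locus_def)
  moreover have "card {i} = CARD('n) - 1 - (n - 1)"
    using assms(1,2) by simp
  ultimately show False
    using assms(3) unfolding \<Delta>_def by blast
qed


section \<open>Hadamard translates of a hyperplane\<close>

definition recip_coords :: "'n::finite proj \<Rightarrow> complex^'n" where
  "recip_coords P = (\<chi> i. 1 / coords P $ i)"

lemma cremona_eq_point_recip_coords: "\<sigma> P = point (recip_coords P)"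
  by (simp add: cremona_def recip_coords_def)

lemma zariski_closure_closed: "zariski_closed Z \<Longrightarrow> zariski_closure Z = Z"
  unfolding zariski_closure_def by blast

text \<open>
  The point \<open>Q\<close> lies on \<open>V(a)\<close> iff \<open>P \<star> Q\<close> lies on \<open>V(a / p)\<close>, because the factors \<open>p\<^sub>i\<close> cancel
  in each term. Multiplication by \<open>P\<close> is bijective on points, so the products already fill the
  target hyperplane and taking the Zariski closure adds nothing.
\<close>

lemma hadamard_variety_hyperplane:
  fixes P :: "'n::finite proj"
  assumes nz: "\<And>i. coords P $ i \<noteq> 0"
  shows "P \<star> zero_locus {lin_form a} = zero_locus {lin_form (a * recip_coords P)}"
proof -
  let ?p = "coords P" and ?q = "recip_coords P"
  have cancel: "?q * (?p * v) = v" "?p * (?q * v) = v" for v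
    using nz by (simp_all add: recip_coords_def vec_eq_iff)
  have had: "hadamard P (point v) = Some (point (?p * v))" if "v \<noteq> 0" for v
    using hadamard_point[OF coords_nonzero[of P] that] that nz
    by (auto simp: point_coords vec_eq_iff)
  have eval: "lin_form (a * ?q) (?p * v) = lin_form a v" for v
    using nz by (simp add: lin_form_def recip_coords_def)
  have "{R. \<exists>Q\<in>zero_locus {lin_form a}. hadamard P Q = Some R} =
      zero_locus {lin_form (a * ?q)}" (is "?X = ?Y")
  proof
    show "?X \<subseteq> ?Y"
    proof clarify
      fix Q R assume Q: "Q \<in> zero_locus {lin_form a}" and R: "hadamard P Q = Some R"
      have "?p * coords Q \<noteq> 0"
        using cancel(1)[of "coords Q"] coords_nonzero[of Q] by auto
      moreover have "R = point (?p * coords Q)"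
        using R had[OF coords_nonzero[of Q]] by (simp add: point_coords)
      ultimately show "R \<in> ?Y"
        using Q by (simp add: point_in_lin_form_hyperplane eval) (simp add: zero_locus_def)
    qed
    show "?Y \<subseteq> ?X"
    proof
      fix R assume R: "R \<in> ?Y"
      let ?v = "?q * coords R"
      have v: "?v \<noteq> 0"
        using cancel(2)[of "coords R"] coords_nonzero[of R] by auto
      have "lin_form a ?v = 0"
        using R eval[of ?v] by (simp add: cancel zero_locus_def)
      then have "point ?v \<in> zero_locus {lin_form a}"
        using v by (simp add: point_in_lin_form_hyperplane)
      moreover have "hadamard P (point ?v) = Some R"
        using had[OF v] by (simp add: cancel point_coords)
      ultimately show "R \<in> ?X"
        by blast
    qed
  qed
  moreover have "zariski_closed ?Y"
    unfolding zariski_closed_def using lin_form_in_forms by blast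
  ultimately show ?thesis
    by (simp add: hadamard_variety_def zariski_closure_closed)
qed


section \<open>Position of the points and intersections of the hyperplanes\<close>

text \<open>
  A common zero \<open>v\<close> of the forms with coefficients \<open>a * q\<^sub>i\<close> is the same as a linear form with
  coefficients \<open>a * v\<close> vanishing at all \<open>q\<^sub>i\<close>, so the failures on both sides correspond under
  \<open>h = a * v\<close>.
\<close>

lemma general_position_cremona_iff:
  fixes P :: "nat \<Rightarrow> 'n::finite proj"
  assumes a: "\<And>j. a $ j \<noteq> 0" and P: "\<And>i j. i \<in> {1..r} \<Longrightarrow> coords (P i) $ j \<noteq> 0"
  shows "general_position r (\<lambda>i. \<sigma> (P i)) \<longleftrightarrow>
    (\<forall>I \<subseteq> {1..r}. card I = CARD('n) \<longrightarrow>
      (\<Inter>i\<in>I. zero_locus {lin_form (a * recip_coords (P i))}) = {})"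
proof -
  let ?q = "\<lambda>i. recip_coords (P i)"
  have q: "?q i \<noteq> 0" if "i \<in> {1..r}" for i
    using P[OF that] by (auto simp: recip_coords_def vec_eq_iff)
  have a_mult: "a * v = 0 \<longleftrightarrow> v = 0" for v
    using a by (simp add: vec_eq_iff)
  have a_div: "\<exists>v. h = a * v" for h
    using a by (intro exI[of _ "\<chi> j. h $ j / a $ j"]) (simp add: vec_eq_iff)
  have on_hyperplane: "(\<exists>H. hyperplane H \<and> (\<lambda>i. \<sigma> (P i)) ` I \<subseteq> H) \<longleftrightarrow>
      (\<Inter>i\<in>I. zero_locus {lin_form (a * ?q i)}) \<noteq> {}" if I: "I \<subseteq> {1..r}" for I
  proof -
    have on: "(\<lambda>i. \<sigma> (P i)) ` I \<subseteq> zero_locus {lin_form h} \<longleftrightarrow> (\<forall>i\<in>I. lin_form h (?q i) = 0)"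
      for h
      using I q by (auto simp: cremona_eq_point_recip_coords point_in_lin_form_hyperplane subset_iff)
    have "(\<exists>H. hyperplane H \<and> (\<lambda>i. \<sigma> (P i)) ` I \<subseteq> H) \<longleftrightarrow>
        (\<exists>h. h \<noteq> 0 \<and> (\<lambda>i. \<sigma> (P i)) ` I \<subseteq> zero_locus {lin_form h})"
      unfolding hyperplane_iff by blast
    also have "\<dots> \<longleftrightarrow> (\<exists>h. h \<noteq> 0 \<and> (\<forall>i\<in>I. lin_form h (?q i) = 0))"
      by (simp only: on)
    also have "\<dots> \<longleftrightarrow> (\<exists>v. v \<noteq> 0 \<and> (\<forall>i\<in>I. lin_form (a * v) (?q i) = 0))"
    proof
      assume "\<exists>h. h \<noteq> 0 \<and> (\<forall>i\<in>I. lin_form h (?q i) = 0)"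
      then obtain h where h: "h \<noteq> 0" "\<forall>i\<in>I. lin_form h (?q i) = 0"
        by blast
      obtain v where "h = a * v"
        using a_div by blast
      then show "\<exists>v. v \<noteq> 0 \<and> (\<forall>i\<in>I. lin_form (a * v) (?q i) = 0)"
        using h a_mult by blast
    next
      assume "\<exists>v. v \<noteq> 0 \<and> (\<forall>i\<in>I. lin_form (a * v) (?q i) = 0)"
      then show "\<exists>h. h \<noteq> 0 \<and> (\<forall>i\<in>I. lin_form h (?q i) = 0)"
        using a_mult by blast
    qed
    also have "\<dots> \<longleftrightarrow> (\<Inter>i\<in>I. zero_locus {lin_form (a * ?q i)}) \<noteq> {}"
      unfolding lin_form_locus_empty_iff lin_form_mult[of a "?q _"] by blast
    finally show ?thesis .
  qed
  have "general_position r (\<lambda>i. \<sigma> (P i)) \<longleftrightarrow>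
      (\<forall>I. I \<subseteq> {1..r} \<longrightarrow> card I = CARD('n) \<longrightarrow>
        \<not> (\<exists>H. hyperplane H \<and> (\<lambda>i. \<sigma> (P i)) ` I \<subseteq> H))"
    unfolding general_position_def by iprover
  then show ?thesis
    by (simp add: on_hyperplane cong: imp_cong)
qed


section \<open>Generality is decided by maximal independent subsets\<close>

text \<open>
  Evaluating \<open>N = CARD('n)\<close> forms with no common zero is an injective linear map into
  \<open>complex^'n\<close>. The common zeros of a subset of these forms are mapped onto the vectors whose
  corresponding coordinates vanish, whose dimension is known.
\<close>

lemma dim_common_zeros:
  fixes b :: "nat \<Rightarrow> complex^'n::finite"
  assumes J: "card J = CARD('n)" and I: "I \<subseteq> J"
    and indep: "\<And>v. \<forall>i\<in>J. lin_form (b i) v = 0 \<Longrightarrow> v = 0"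
  shows "vec.dim {v. \<forall>i\<in>I. lin_form (b i) v = 0} = CARD('n) - card I"
proof -
  have "finite J"
    using J by (metis card.infinite zero_less_card_finite less_irrefl)
  then obtain e :: "'n \<Rightarrow> nat" where e: "bij_betw e UNIV J"
    using finite_same_card_bij[of "UNIV :: 'n set" J] J by auto
  define A :: "complex^'n^'n" where "A = (\<chi> j. b (e j))"
  define K where "K = {j. e j \<in> I}"
  have A: "(A *v v) $ j = lin_form (b (e j)) v" for v j
    by (simp add: A_def matrix_vector_mult_def lin_form_def)
  have J_eq: "J = range e"
    using e by (simp add: bij_betw_def)
  have ker: "v = 0" if "A *v v = 0" for v
    using that by (intro indep) (auto simp: J_eq simp flip: A)
  have inj: "inj ((*v) A)"
  proof (rule injI)
    fix x y assume "A *v x = A *v y"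
    then have "A *v (x - y) = 0"
      by (simp add: matrix_vector_mult_diff_distrib)
    then show "x = y"
      using ker by fastforce
  qed
  then have surj: "surj ((*v) A)"
    by (simp add: vec.linear_injective_imp_surjective)
  let ?V = "{v. \<forall>i\<in>I. lin_form (b i) v = 0}"
  have V: "v \<in> ?V \<longleftrightarrow> (\<forall>j. j \<notin> - K \<longrightarrow> (A *v v) $ j = 0)" for v
    using I by (auto simp: A K_def J_eq)
  have "(*v) A ` ?V = {w. \<forall>j. j \<notin> - K \<longrightarrow> w $ j = 0}"
    unfolding set_eq_iff using surj V by (auto simp: image_iff surj_def) metis
  moreover have "vec.dim ((*v) A ` ?V) = vec.dim ?V"
    by (rule vec.dim_image_eq) (auto intro: inj_on_subset[OF inj])
  ultimately have "vec.dim ?V = card (- K)"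
    by (simp only: dim_substandard_cart)
  also have "\<dots> = CARD('n) - card K"
    by (simp add: Compl_eq_Diff_UNIV card_Diff_subset)
  also have "card K = card I"
  proof -
    have "e ` K = I"
      using I by (auto simp: K_def J_eq)
    moreover have "inj_on e K"
      using e by (auto simp: bij_betw_def intro: inj_on_subset)
    ultimately show ?thesis
      by (metis card_image)
  qed
  finally show ?thesis .
qed

text \<open>
  Too many forms contain \<open>CARD('n)\<close> of them, and too few can be completed to \<open>CARD('n)\<close> of them
  as long as the family is long enough, so only subsets of that one size have to be tested.
\<close>

lemma generally_linear_lin_formI:
  fixes b :: "nat \<Rightarrow> complex^'n::finite"
  assumes r: "r \<ge> CARD('n)"
    and empty: "\<And>I. I \<subseteq> {1..r} \<Longrightarrow> card I = CARD('n) \<Longrightarrow>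
      (\<Inter>i\<in>I. zero_locus {lin_form (b i)}) = {}"
  shows "generally_linear r (\<lambda>i. lin_form (b i))"
  unfolding generally_linear_def
proof (intro conjI ballI allI impI lin_form_in_forms)
  fix I assume I: "I \<subseteq> {1..r}" and card_I: "card I \<le> CARD('n) - 1"
  obtain J where J: "I \<subseteq> J" "J \<subseteq> {1..r}" "card J = CARD('n)"
    using exists_subset_between[of I "CARD('n)" "{1..r}"] I le_trans[OF card_I diff_le_self] r
    by auto
  have indep: "v = 0" if "\<forall>i\<in>J. lin_form (b i) v = 0" for v
    using empty[OF J(2,3)] that unfolding lin_form_locus_empty_iff by blast
  have "{v. v = 0 \<or> point v \<in> zero_locus ((\<lambda>i. lin_form (b i)) ` I)} =
      {v. \<forall>i\<in>I. lin_form (b i) v = 0}"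
  proof -
    have "lin_form (b i) 0 = 0" for i
      by (simp add: lin_form_def)
    then show ?thesis
      unfolding zero_locus_image by (auto simp: point_in_lin_form_hyperplane)
        (metis point_in_lin_form_hyperplane)
  qed
  then have "proj_dim (zero_locus ((\<lambda>i. lin_form (b i)) ` I)) = int (CARD('n) - card I) - 1"
    by (simp add: proj_dim_def dim_common_zeros[OF J(3,1) indep])
  moreover have "CARD('n) > 0"
    by simp
  ultimately show "proj_dim (zero_locus ((\<lambda>i. lin_form (b i)) ` I)) =
      int (CARD('n) - 1) - int (card I)"
    using card_I by linarith
next
  fix I assume I: "I \<subseteq> {1..r}" and card_I: "card I > CARD('n) - 1"
  then have "CARD('n) \<le> card I"
    by linarith
  then obtain J where "J \<subseteq> I" "card J = CARD('n)"
    by (rule obtain_subset_with_card_n)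
  moreover from this have "(\<Inter>i\<in>J. zero_locus {lin_form (b i)}) = {}"
    using empty I by blast
  ultimately show "zero_locus ((\<lambda>i. lin_form (b i)) ` I) = {}"
    unfolding zero_locus_image by blast
qed


section \<open>Hadamard star configurations and general position\<close>

theorem corollary4p7:
  fixes n c r :: nat
    and H :: "'n::finite proj set"
    and P :: "nat \<Rightarrow> 'n proj"
    and Hs :: "nat \<Rightarrow> 'n proj set"
  assumes "CARD('n) = n + 1"
    and "n \<ge> 1"
    and "1 \<le> c" and "c \<le> n"
    and "r \<ge> n + 1"
    and "hyperplane H"
    and "H \<inter> \<Delta> 0 = {}"
    and "\<And>i. i \<in> {1..r} \<Longrightarrow> P i \<in> H - \<Delta> (n - 1)"
    and "\<And>i. i \<in> {1..r} \<Longrightarrow> Hs i = P i \<star> H"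
  shows "hadamard_star_configuration c r Hs \<longleftrightarrow> general_position r (\<lambda>i. \<sigma> (P i))"
proof -
  obtain a where H: "H = zero_locus {lin_form a}"
    using assms(6) unfolding hyperplane_iff by blast
  have a: "a $ j \<noteq> 0" for j
    using coefficients_nonzero_if_disjoint_Delta_0 assms(7) unfolding H .
  have P: "coords (P i) $ j \<noteq> 0" if "i \<in> {1..r}" for i j
    using coords_nonzero_if_notin_Delta[OF assms(1,2)] assms(8)[OF that] by blast
  define b where "b i = a * recip_coords (P i)" for i
  have Hs: "Hs i = zero_locus {lin_form (b i)}" if "i \<in> {1..r}" for i
    using assms(9)[OF that] hadamard_variety_hyperplane[OF P[OF that]] by (simp add: H b_def)
  have inter: "(\<Inter>i\<in>I. Hs i) = (\<Inter>i\<in>I. zero_locus {lin_form (b i)})" if "I \<subseteq> {1..r}" for I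
    using that Hs by (intro INF_cong) auto
  have gp: "general_position r (\<lambda>i. \<sigma> (P i)) \<longleftrightarrow>
      (\<forall>I \<subseteq> {1..r}. card I = CARD('n) \<longrightarrow> (\<Inter>i\<in>I. Hs i) = {})"
    using general_position_cremona_iff[OF a P] inter by (auto simp: b_def)
  show ?thesis
  proof
    assume "hadamard_star_configuration c r Hs"
    then obtain L where L: "\<forall>i\<in>{1..r}. Hs i = zero_locus {L i}" and gl: "generally_linear r L"
      unfolding hadamard_star_configuration_def star_configuration_def by blast
    \<comment> \<open>The forms \<open>L\<close> need not be the \<open>lin_form (b i)\<close>, but empty intersections depend only on
      the hyperplanes.\<close>
    show "general_position r (\<lambda>i. \<sigma> (P i))"
      unfolding gp
    proof (intro allI impI)
      fix I assume I: "I \<subseteq> {1..r}" and "card I = CARD('n)"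
      then have "zero_locus (L ` I) = {}"
        using gl unfolding generally_linear_def by (metis assms(1) add_diff_cancel_right' less_add_one)
      then show "(\<Inter>i\<in>I. Hs i) = {}"
        using I L unfolding zero_locus_image by (metis (no_types, lifting) INF_cong subsetD)
    qed
  next
    assume "general_position r (\<lambda>i. \<sigma> (P i))"
    then have "generally_linear r (\<lambda>i. lin_form (b i))"
      using assms(1,5) inter unfolding gp by (intro generally_linear_lin_formI) auto
    moreover have "\<X> c r Hs =
        (\<Union>I \<in> {I. I \<subseteq> {1..r} \<and> card I = c}. zero_locus ((\<lambda>i. lin_form (b i)) ` I))"
      unfolding star_locus_def zero_locus_image using inter by (intro SUP_cong) auto
    moreover have "strong_hadamard_set r (\<lambda>i. lin_form (b i))"
      unfolding strong_hadamard_set_def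
    proof (intro bexI exI ballI conjI)
      fix i assume i: "i \<in> {1..r}"
      show "zero_locus {lin_form (b i)} = P i \<star> zero_locus {lin_form a}"
        using Hs[OF i] assms(9)[OF i] by (simp add: H)
      show "P i \<in> zero_locus {lin_form a}"
        using assms(8)[OF i] by (simp add: H)
    qed (rule lin_form_in_forms)
    ultimately show "hadamard_star_configuration c r Hs"
      unfolding hadamard_star_configuration_def star_configuration_def
      using Hs assms(1,3,4) by (intro exI[of _ "\<lambda>i. lin_form (b i)"]) auto
  qed
qed

end
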